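(* Let $m\ge1$, $j\ge 0$ be integers such that $\gcd(2^m-1,2^j+1)=1$ and $\gcd(2^m-1,2^j-1)=2^k-1$, let $e=2^m-2^j-2$, and let $d$ be the inverse of $e$ modulo $2^m-1$. Let $\{\alpha_0,\dots,\alpha_{k-1}\}$ be a basis of $\mathbb{F}_{2^k}$ over $\mathbb{F}_2$. Then the functions $f_1,f_2:\mathbb{F}_{2^m}\times\mathbb{F}_{2^m}\to\mathbb{Z}_{2^k}$, \[ f_1(x,y)=\sum_{i=0}^{k-1}{\rm Tr}_m(\alpha_ixy^d)2^i,\qquad f_2(x,y)=\sum_{i=0}^{k-1}{\rm Tr}_m(\alpha_i^{-e}x^ey)2^i, \] are $\mathbb{Z}_{2^k}$-bent functions.
   Context: ${\rm Tr}_m$ is the absolute trace $\mathbb{F}_{2^m}\to\mathbb{F}_2$, and its values $0,1$ are regarded as integers, the sums being computed in $\mathbb{Z}_{2^k}$. $\mathbb{F}_{2^k}\subseteq\mathbb{F}_{2^m}$. Powers of nonzero field elements are taken with exponents modulo $2^m-1$; all powers of $0$ equal $0$. A function $f:\mathbb{F}_{2^m}\times\mathbb{F}_{2^m}\to\mathbb{Z}_{2^k}$ is $\mathbb{Z}_{2^k}$-bent if $\left|\sum_{x,y\in\mathbb{F}_{2^m}}\zeta^{af(x,y)}(-1)^{{\rm Tr}_m(ux+vy)}\right|=2^m$ for all nonzero $a\in\mathbb{Z}_{2^k}$ and all $u,v\in\mathbb{F}_{2^m}$, where $\zeta$ is a complex primitive $2^k$-th root of unity. *)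

theory Defs
  imports "HOL-Analysis.Analysis" "HOL-Number_Theory.Number_Theory"
begin

definition abs_trace :: "nat \<Rightarrow> 'a::finite_field \<Rightarrow> 'a" where
  "abs_trace m x = (\<Sum>i<m. x ^ (2 ^ i))"

(* The trace value, an element of the prime field {0,1} by abs_trace_in_prime_field below,
   read as an integer. *)
definition trace_int :: "nat \<Rightarrow> 'a::finite_field \<Rightarrow> int" where
  "trace_int m x = (if abs_trace m x = 0 then 0 else 1)"

(* For x \<noteq> 0 the value depends only on n modulo CARD('a) - 1, see field_pow_cong.
   All powers of 0 are 0, including the one with exponent 0, unlike for powi. *)
definition field_pow :: "'a::finite_field \<Rightarrow> int \<Rightarrow> 'a" where
  "field_pow x n = (if x = 0 then 0 else x powi n)"

definition is_subfield :: "'a::field set \<Rightarrow> bool" where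
  "is_subfield K \<longleftrightarrow> 0 \<in> K \<and> 1 \<in> K \<and>
     (\<forall>x\<in>K. \<forall>y\<in>K. x + y \<in> K \<and> x * y \<in> K) \<and>
     (\<forall>x\<in>K. - x \<in> K \<and> inverse x \<in> K)"

(* The prime field of a field of characteristic 2 is the set {0,1}. *)
definition is_F2_basis :: "nat \<Rightarrow> (nat \<Rightarrow> 'a::finite_field) \<Rightarrow> 'a set \<Rightarrow> bool" where
  "is_F2_basis k \<alpha> K \<longleftrightarrow>
     {\<Sum>i<k. c i * \<alpha> i | c. \<forall>i<k. c i \<in> {0, 1}} = K \<and>
     (\<forall>c. (\<forall>i<k. c i \<in> {0, 1}) \<and> (\<Sum>i<k. c i * \<alpha> i) = 0 \<longrightarrow> (\<forall>i<k. c i = 0))"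

definition primitive_root_of_unity :: "nat \<Rightarrow> complex \<Rightarrow> bool" where
  "primitive_root_of_unity n \<zeta> \<longleftrightarrow> \<zeta> ^ n = 1 \<and> (\<forall>l. 0 < l \<and> l < n \<longrightarrow> \<zeta> ^ l \<noteq> 1)"

(* The ring of integers modulo 2^k is represented by the residues {0..<2^k}; the domain is the
   square of the field 'a, which is meant to have 2^m elements. *)
definition Z_bent :: "nat \<Rightarrow> nat \<Rightarrow> ('a::finite_field \<Rightarrow> 'a \<Rightarrow> int) \<Rightarrow> bool" where
  "Z_bent m k f \<longleftrightarrow>
     (\<forall>x y. f x y \<in> {0..<2 ^ k}) \<and>
     (\<forall>\<zeta>. primitive_root_of_unity (2 ^ k) \<zeta> \<longrightarrow>
       (\<forall>a\<in>{0..<2 ^ k} - {0}. \<forall>u v.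
         cmod (\<Sum>x\<in>UNIV. \<Sum>y\<in>UNIV.
           \<zeta> powi (a * f x y) * (- 1) powi trace_int m (u * x + v * y)) = 2 ^ m))"

lemma CHAR_eq_2_if_CARD:
  assumes "CARD('a::finite_field) = 2 ^ m"
  shows "CHAR('a) = 2"
proof -
  have "prime CHAR('a)"
    using prime_CHAR_semidom[where ?'a = 'a] CHAR_pos[where ?'a = 'a] by simp
  moreover have "CHAR('a) dvd 2 ^ m"
    using CHAR_dvd_CARD[where ?'a = 'a] assms by simp
  ultimately have "CHAR('a) dvd 2"
    using prime_dvd_power by blast
  with \<open>prime CHAR('a)\<close> show ?thesis
    using primes_dvd_imp_eq[of "CHAR('a)" 2] by simp
qed

lemma abs_trace_in_prime_field:
  fixes x :: "'a::finite_field"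
  assumes card: "CARD('a) = 2 ^ m"
  shows "abs_trace m x \<in> {0, 1}"
proof -
  have char: "CHAR('a) = 2" by (rule CHAR_eq_2_if_CARD[OF card])
  have "abs_trace m x ^ 2 = (\<Sum>i<m. (x ^ (2 ^ i)) ^ 2)"
    unfolding abs_trace_def
    by (rule freshmans_dream_sum) (simp_all only: char two_is_prime_nat)
  also have "\<dots> = (\<Sum>i<m. x ^ (2 ^ Suc i))"
    by (rule sum.cong[OF refl]) (subst power_Suc2, rule power_mult[symmetric])
  also have "\<dots> = abs_trace m x"
  proof -
    have "(\<Sum>i<Suc m. x ^ (2 ^ i)) = x + (\<Sum>i<m. x ^ (2 ^ Suc i))"
      by (subst sum.lessThan_Suc_shift) (simp only: power_0 power_one_right)
    moreover have "(\<Sum>i<Suc m. x ^ (2 ^ i)) = abs_trace m x + x"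
      unfolding abs_trace_def sum.lessThan_Suc
      using finite_field_power_card_eq_same[of x] by (simp only: card)
    ultimately have "x + (\<Sum>i<m. x ^ (2 ^ Suc i)) = x + abs_trace m x"
      by (simp only: add.commute)
    then show ?thesis by (rule add_left_imp_eq)
  qed
  finally have "abs_trace m x * abs_trace m x = abs_trace m x * 1"
    by (simp only: power2_eq_square mult_1_right)
  then have "abs_trace m x = 0 \<or> abs_trace m x = 1" by (simp only: mult_cancel_left)
  then show ?thesis by blast
qed

lemma field_pow_cong:
  fixes x :: "'a::finite_field"
  assumes "[n = n'] (mod (int CARD('a) - 1))"
  shows "field_pow x n = field_pow x n'"
proof (cases "x = 0")
  case False
  have pos: "CARD('a) > 0" by (simp add: finite_UNIV_card_ge_0)
  have "x * x ^ (CARD('a) - 1) = x"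
    using finite_field_power_card_eq_same[of x] pos
    by (cases "CARD('a)") auto
  with False have one: "x ^ (CARD('a) - 1) = 1" by simp
  have "(int CARD('a) - 1) dvd n - n'"
    using assms by (simp add: cong_iff_dvd_diff)
  then obtain t where "n - n' = (int CARD('a) - 1) * t" ..
  then have t: "n = n' + (int CARD('a) - 1) * t" by simp
  have "x powi (int CARD('a) - 1) = 1"
    using one pos power_int_of_nat[of x "CARD('a) - 1"] by simp
  with False show ?thesis
    by (simp add: field_pow_def t power_int_add power_int_mult)
qed (simp add: field_pow_def)

end

theory Submission
  imports Defs
begin

text \<open>
  Put \<open>\<omega>\<^sub>i = \<zeta>\<^bsup>a 2^i\<^esup>\<close>. For a bit \<open>t\<close> one has
  \<open>\<omega>\<^sub>i\<^sup>t = (1 + \<omega>\<^sub>i)/2 + (-1)\<^sup>t (1 - \<omega>\<^sub>i)/2\<close>, so multiplying out over \<open>i\<close> writes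
  \<open>\<zeta>\<close> to the power \<open>a \<Sum>\<^sub>i Tr(\<gamma>\<^sub>i x \<pi>(y)) 2^i\<close> as a combination, with weights \<open>w\<^sub>S\<close>, of the additive characters
  \<open>(-1)\<^bsup>Tr(\<gamma>\<^sub>S x \<pi>(y))\<^esup>\<close>, where \<open>S\<close> ranges over sets of indices and \<open>\<gamma>\<^sub>S = \<Sum>\<^bsub>i\<in>S\<^esub> \<gamma>\<^sub>i\<close>. Some \<open>\<omega>\<^sub>i\<close> equals \<open>-1\<close>,
  hence \<open>w\<^sub>\<emptyset> = 0\<close>. Summing over \<open>x\<close> leaves the \<open>y\<close> with \<open>\<gamma>\<^sub>S \<pi>(y) = u\<close>. On the subfield, \<open>-e\<close> acts as
  squaring, so for \<open>S \<noteq> \<emptyset>\<close> this \<open>y\<close> is unique and additive in \<open>S\<close>, namely \<open>\<delta>\<^sub>S\<close> for suitable \<open>\<delta>\<^sub>i\<close>. The same product formula,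
  read backwards with \<open>v \<delta>\<^sub>i\<close> in place of \<open>\<gamma>\<^sub>i x \<pi>(y)\<close>, turns the remaining sum into \<open>2^m\<close> times
  a product of powers of the \<open>\<omega>\<^sub>i\<close>.
\<close>

section \<open>The canonical additive character\<close>

lemma char_2_add_self:
  fixes x :: "'a::finite_field"
  assumes "CARD('a) = 2 ^ m"
  shows "x + x = 0"
proof -
  have "of_nat 2 = (0::'a)"
    using of_nat_CHAR[where ?'a = 'a] by (simp only: CHAR_eq_2_if_CARD[OF assms])
  then have "(2::'a) = 0" by simp
  then show ?thesis by (metis mult_2 mult_zero_left)
qed

lemma abs_trace_0: "abs_trace m 0 = 0"
  by (auto simp: abs_trace_def power_0_left intro: sum.neutral)

lemma abs_trace_add:
  fixes x y :: "'a::finite_field"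
  assumes "CARD('a) = 2 ^ m"
  shows "abs_trace m (x + y) = abs_trace m x + abs_trace m y"
proof -
  have "(x + y) ^ (2 ^ i) = x ^ (2 ^ i) + y ^ (2 ^ i)" for i
    using freshmans_dream'[of "2 ^ i" i x y] by (simp add: CHAR_eq_2_if_CARD[OF assms])
  then show ?thesis by (simp add: abs_trace_def sum.distrib)
qed

text \<open>The trace is a polynomial function of degree at most \<open>2 ^ (m - 1)\<close>, less
  than the number \<open>2 ^ m\<close> of field elements, and its coefficient there is 1, so it
  cannot vanish everywhere.\<close>

lemma ex_abs_trace_nonzero:
  assumes "CARD('a::finite_field) = 2 ^ m" and "m \<ge> 1"
  shows "\<exists>x::'a. abs_trace m x \<noteq> 0"
proof (rule ccontr)
  assume "\<not> ?thesis"
  then have zero: "abs_trace m x = 0" for x :: 'a by blast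
  define p :: "'a poly" where "p = (\<Sum>i<m. Polynomial.monom 1 (2 ^ i))"
  have "poly p x = abs_trace m x" for x
    by (simp add: p_def abs_trace_def poly_sum poly_monom)
  with zero have roots: "{x. poly p x = 0} = UNIV" by simp
  have "Polynomial.coeff p (2 ^ (m - 1)) = (\<Sum>i<m. if i = m - 1 then 1 else 0)"
    unfolding p_def Polynomial.coeff_sum by (intro sum.cong) (auto simp: Polynomial.coeff_monom)
  also have "\<dots> = 1" using \<open>m \<ge> 1\<close> by simp
  finally have "p \<noteq> 0" by auto
  then have "card {x. poly p x = 0} \<le> Polynomial.degree p" by (rule card_poly_roots_bound)
  also have "Polynomial.degree p \<le> 2 ^ (m - 1)"
    unfolding p_def
  proof (rule Polynomial.degree_sum_le)
    fix i assume "i \<in> {..<m}"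
    then have "(2::nat) ^ i \<le> 2 ^ (m - 1)" by (intro power_increasing) auto
    then show "Polynomial.degree (Polynomial.monom (1::'a) (2 ^ i)) \<le> 2 ^ (m - 1)"
      by (simp add: Polynomial.degree_monom_eq)
  qed simp
  finally have "(2::nat) ^ m \<le> 2 ^ (m - 1)" by (simp only: roots assms(1))
  with \<open>m \<ge> 1\<close> show False by simp
qed

definition add_char :: "nat \<Rightarrow> 'a::finite_field \<Rightarrow> complex" where
  "add_char m x = (- 1) powi trace_int m x"

lemma add_char_eq: "add_char m x = (if abs_trace m x = 0 then 1 else - 1)"
  by (simp add: add_char_def trace_int_def)

lemma add_char_add:
  fixes x y :: "'a::finite_field"
  assumes "CARD('a) = 2 ^ m"
  shows "add_char m (x + y) = add_char m x * add_char m y"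
  using abs_trace_in_prime_field[OF assms, of x] abs_trace_in_prime_field[OF assms, of y]
    char_2_add_self[OF assms, of 1]
  by (auto simp: add_char_eq abs_trace_add[OF assms])

lemma add_char_sum:
  fixes g :: "nat \<Rightarrow> 'a::finite_field"
  assumes "CARD('a) = 2 ^ m" and "finite S"
  shows "add_char m (sum g S) = (\<Prod>i\<in>S. add_char m (g i))"
  using \<open>finite S\<close>
proof (induction S rule: finite_induct)
  case empty
  then show ?case by (simp add: add_char_eq abs_trace_0)
next
  case (insert i S)
  then show ?case by (simp add: add_char_add[OF assms(1)])
qed

text \<open>For \<open>b \<noteq> 0\<close>, translating the variable by \<open>z / b\<close>, where
  \<open>z\<close> has nonzero trace, negates every term, so the sum equals its own
  negative.\<close>

lemma sum_add_char:
  fixes b :: "'a::finite_field"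
  assumes "CARD('a) = 2 ^ m" and "m \<ge> 1"
  shows "(\<Sum>x\<in>UNIV. add_char m (b * x)) = (if b = 0 then 2 ^ m else 0)"
proof (cases "b = 0")
  case True
  then show ?thesis using assms(1) by (simp add: add_char_eq abs_trace_0)
next
  case False
  obtain z :: 'a where z: "abs_trace m z \<noteq> 0" using ex_abs_trace_nonzero[OF assms] by blast
  let ?s = "\<Sum>x\<in>UNIV. add_char m (b * x)"
  have "?s = (\<Sum>x\<in>UNIV. add_char m (b * (x + z / b)))"
    by (rule sum.reindex_bij_witness[of _ "\<lambda>x. x + z / b" "\<lambda>x. x - z / b"]) auto
  also have "\<dots> = (\<Sum>x\<in>UNIV. - add_char m (b * x))"
    using False z
    by (intro sum.cong) (simp_all add: distrib_left add_char_add[OF assms(1)] add_char_eq[of m z])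
  also have "\<dots> = - ?s" by (simp add: sum_negf)
  finally show ?thesis using False by simp
qed

section \<open>Expansion into additive characters\<close>

text \<open>Repeated squaring takes \<open>\<zeta> powi a\<close>, which is not 1, to 1 within
  \<open>k\<close> steps. The value just before 1 is first reached is a square root of 1 other than
  1.\<close>

lemma ex_double_power_minus_one:
  fixes \<zeta> :: complex
  assumes "primitive_root_of_unity (2 ^ k) \<zeta>" and "a \<in> {0..<2 ^ k} - {0::int}"
  shows "\<exists>i<k. \<zeta> powi (a * 2 ^ i) = - 1"
proof -
  obtain b where b: "a = int b"
    using assms(2) by (metis Diff_iff atLeastLessThan_iff zero_le_imp_eq_int)
  have "0 < b" "b < 2 ^ k" using assms(2) by (auto simp: b)
  define w where "w i = \<zeta> powi (a * 2 ^ i)" for i :: nat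
  have w: "w i = \<zeta> ^ (b * 2 ^ i)" for i
    unfolding w_def b power_int_of_nat[symmetric] by simp
  have one: "\<zeta> ^ (2 ^ k) = 1" using assms(1) by (simp add: primitive_root_of_unity_def)
  have w0: "w 0 \<noteq> 1"
    using assms(1) \<open>0 < b\<close> \<open>b < 2 ^ k\<close> by (simp add: w primitive_root_of_unity_def)
  have "w k = (\<zeta> ^ (2 ^ k)) ^ b" unfolding w by (subst mult.commute) (rule power_mult)
  then have wk: "w k = 1" by (simp add: one)
  define n where "n = (LEAST n. w n = 1)"
  have n: "w n = 1" unfolding n_def using wk by (rule LeastI)
  have "n \<le> k" unfolding n_def using wk by (rule Least_le)
  obtain i where i: "n = Suc i" using n w0 by (cases n) auto
  have "w i \<noteq> 1" using not_less_Least[of i "\<lambda>n. w n = 1"] by (simp add: n_def[symmetric] i)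
  moreover have "w i ^ 2 = 1"
    using n by (simp add: w i mult.assoc flip: power_mult) (simp add: mult.commute)
  ultimately have "w i = - 1" by (simp add: power2_eq_1_iff)
  then show ?thesis using \<open>n \<le> k\<close> i w_def by (intro exI[of _ i]) simp
qed

text \<open>The Walsh coefficient, at the indicator of \<open>S\<close>, of the map sending bits
  \<open>t i\<close> to the product of the \<open>\<omega> i ^ t i\<close> over
  \<open>i < k\<close>.\<close>

definition bit_weight :: "nat \<Rightarrow> (nat \<Rightarrow> complex) \<Rightarrow> nat set \<Rightarrow> complex" where
  "bit_weight k \<omega> S = (\<Prod>i\<in>S. (1 - \<omega> i) / 2) * (\<Prod>i\<in>{..<k} - S. (1 + \<omega> i) / 2)"

lemma prod_trace_powers:
  fixes g :: "nat \<Rightarrow> 'a::finite_field"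
  assumes "CARD('a) = 2 ^ m"
  shows "(\<Prod>i<k. \<omega> i powi trace_int m (g i)) =
    (\<Sum>S\<in>Pow {..<k}. bit_weight k \<omega> S * add_char m (sum g S))"
proof -
  have "(\<Prod>i<k. \<omega> i powi trace_int m (g i)) =
      (\<Prod>i<k. add_char m (g i) * ((1 - \<omega> i) / 2) + (1 + \<omega> i) / 2)"
    by (intro prod.cong) (auto simp: trace_int_def add_char_eq field_simps)
  also have "\<dots> = (\<Sum>S\<in>Pow {..<k}. (\<Prod>i\<in>S. add_char m (g i) * ((1 - \<omega> i) / 2)) *
      (\<Prod>i\<in>{..<k} - S. (1 + \<omega> i) / 2))"
    by (rule prod_add) simp
  also have "\<dots> = (\<Sum>S\<in>Pow {..<k}. bit_weight k \<omega> S * add_char m (sum g S))"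
  proof (rule sum.cong[OF refl])
    fix S assume "S \<in> Pow {..<k}"
    then have "finite S" by (auto intro: finite_subset)
    then show "(\<Prod>i\<in>S. add_char m (g i) * ((1 - \<omega> i) / 2)) * (\<Prod>i\<in>{..<k} - S. (1 + \<omega> i) / 2) =
        bit_weight k \<omega> S * add_char m (sum g S)"
      by (simp only: bit_weight_def add_char_sum[OF assms] prod.distrib mult_ac)
  qed
  finally show ?thesis .
qed

text \<open>Reducing the exponent modulo \<open>2 ^ k\<close> is harmless for a
  \<open>2 ^ k\<close>-th root of unity; the binary digits then split the power into
  factors.\<close>

lemma root_powi_trace_sum:
  fixes g :: "nat \<Rightarrow> 'a::finite_field" and \<zeta> :: complex
  assumes "\<zeta> ^ (2 ^ k) = 1"
  shows "\<zeta> powi (a * ((\<Sum>i<k. trace_int m (g i) * 2 ^ i) mod 2 ^ k)) =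
    (\<Prod>i<k. (\<zeta> powi (a * 2 ^ i)) powi trace_int m (g i))"
proof -
  have "\<zeta> \<noteq> 0" using assms by (auto simp: power_0_left)
  have one: "\<zeta> powi (2 ^ k) = 1"
    using assms power_int_of_nat[of \<zeta> "2 ^ k"] by simp
  define N where "N = (\<Sum>i<k. trace_int m (g i) * 2 ^ i)"
  have "a * N = a * (N mod 2 ^ k) + 2 ^ k * (a * (N div 2 ^ k))"
    by (metis add.commute distrib_left mult.left_commute mult_div_mod_eq)
  then have "\<zeta> powi (a * N) = \<zeta> powi (a * (N mod 2 ^ k))"
    using \<open>\<zeta> \<noteq> 0\<close> by (simp add: power_int_add power_int_mult one)
  moreover have "\<zeta> powi (a * N) = (\<Prod>i<k. (\<zeta> powi (a * 2 ^ i)) powi trace_int m (g i))"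
    unfolding N_def
  proof (induction k)
    case (Suc k)
    then show ?case using \<open>\<zeta> \<noteq> 0\<close>
      by (simp add: distrib_left power_int_add mult_ac flip: power_int_mult)
  qed simp
  ultimately show ?thesis by (simp add: N_def)
qed

text \<open>Serves both functions, with \<open>\<pi>\<close> a power map on the variable summed
  outermost. That the solution in \<open>sol\<close> is a sum over \<open>S\<close> lets the
  surviving characters recombine into one product.\<close>

lemma cmod_trace_sum_transform:
  fixes \<gamma> \<delta> :: "nat \<Rightarrow> 'a::finite_field" and \<pi> :: "'a \<Rightarrow> 'a"
  assumes card: "CARD('a) = 2 ^ m" and m: "m \<ge> 1"
    and \<zeta>: "primitive_root_of_unity (2 ^ k) \<zeta>" and a: "a \<in> {0..<2 ^ k} - {0}"
    and sol: "\<And>S y. S \<subseteq> {..<k} \<Longrightarrow> S \<noteq> {} \<Longrightarrow> sum \<gamma> S * \<pi> y = u \<longleftrightarrow> y = sum \<delta> S"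
  shows "cmod (\<Sum>y\<in>UNIV. \<Sum>x\<in>UNIV.
    \<zeta> powi (a * ((\<Sum>i<k. trace_int m (\<gamma> i * x * \<pi> y) * 2 ^ i) mod 2 ^ k)) *
    (- 1) powi trace_int m (u * x + v * y)) = 2 ^ m"
proof -
  define \<omega> where "\<omega> i = \<zeta> powi (a * 2 ^ i)" for i :: nat
  let ?W = "bit_weight k \<omega>" and ?\<chi> = "add_char m :: 'a \<Rightarrow> complex"
  have one: "\<zeta> ^ (2 ^ k) = 1" using \<zeta> by (simp add: primitive_root_of_unity_def)
  have norm\<zeta>: "cmod \<zeta> = 1"
    using power_eq_1_iff[OF one] by simp
  obtain i0 where "i0 < k" "\<omega> i0 = - 1"
    using ex_double_power_minus_one[OF \<zeta> a] unfolding \<omega>_def by blast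
  then have W0: "?W {} = 0" by (auto simp: bit_weight_def intro!: bexI[of _ i0])
  have diff: "b + c = 0 \<longleftrightarrow> b = c" for b c :: 'a
    using char_2_add_self[OF card, of c] by (metis add_right_cancel)
  have inner: "?W S * (\<Sum>y\<in>UNIV. \<Sum>x\<in>UNIV. ?\<chi> (sum \<gamma> S * x * \<pi> y) * ?\<chi> (u * x + v * y)) =
      2 ^ m * (?W S * ?\<chi> (\<Sum>i\<in>S. v * \<delta> i))" if S: "S \<in> Pow {..<k}" for S
  proof (cases "S = {}")
    \<comment> \<open>\<open>sol\<close> says nothing about the empty set; its vanishing weight
      settles this case.\<close>
    case True
    then show ?thesis by (simp add: W0)
  next
    case False
    have "(\<Sum>y\<in>UNIV. \<Sum>x\<in>UNIV. ?\<chi> (sum \<gamma> S * x * \<pi> y) * ?\<chi> (u * x + v * y)) =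
        (\<Sum>y\<in>UNIV. ?\<chi> (v * y) * (\<Sum>x\<in>UNIV. ?\<chi> ((sum \<gamma> S * \<pi> y + u) * x)))"
      unfolding sum_distrib_left
    proof (intro sum.cong refl)
      fix x y :: 'a
      have "sum \<gamma> S * x * \<pi> y + (u * x + v * y) = v * y + (sum \<gamma> S * \<pi> y + u) * x"
        by (simp only: distrib_right distrib_left ac_simps)
      then show "?\<chi> (sum \<gamma> S * x * \<pi> y) * ?\<chi> (u * x + v * y) =
          ?\<chi> (v * y) * ?\<chi> ((sum \<gamma> S * \<pi> y + u) * x)"
        by (simp only: add_char_add[OF card, symmetric])
    qed
    \<comment> \<open>In characteristic 2 the coefficient of \<open>x\<close> vanishes iff
      \<open>sum \<gamma> S * \<pi> y = u\<close>, so orthogonality keeps a single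
      \<open>y\<close>.\<close>
    also have "\<dots> = (\<Sum>y\<in>UNIV. if y = sum \<delta> S then ?\<chi> (v * y) * 2 ^ m else 0)"
      using S False by (intro sum.cong) (auto simp: sum_add_char[OF card m] diff sol)
    also have "\<dots> = 2 ^ m * ?\<chi> (\<Sum>i\<in>S. v * \<delta> i)"
      by (simp add: sum_distrib_left)
    finally show ?thesis by simp
  qed
  have "(\<Sum>y\<in>UNIV. \<Sum>x\<in>UNIV.
      \<zeta> powi (a * ((\<Sum>i<k. trace_int m (\<gamma> i * x * \<pi> y) * 2 ^ i) mod 2 ^ k)) *
      (- 1) powi trace_int m (u * x + v * y)) =
    (\<Sum>y\<in>UNIV. \<Sum>x\<in>UNIV. \<Sum>S\<in>Pow {..<k}.
      ?W S * (?\<chi> (sum \<gamma> S * x * \<pi> y) * ?\<chi> (u * x + v * y)))"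
    unfolding root_powi_trace_sum[OF one] prod_trace_powers[OF card] \<omega>_def[symmetric]
      add_char_def[symmetric]
    by (simp only: sum_distrib_right sum_distrib_left mult.assoc)
  also have "\<dots> = (\<Sum>y\<in>UNIV. \<Sum>S\<in>Pow {..<k}. \<Sum>x\<in>UNIV.
      ?W S * (?\<chi> (sum \<gamma> S * x * \<pi> y) * ?\<chi> (u * x + v * y)))"
    by (intro sum.cong refl sum.swap)
  also have "\<dots> = (\<Sum>S\<in>Pow {..<k}. \<Sum>y\<in>UNIV. \<Sum>x\<in>UNIV.
      ?W S * (?\<chi> (sum \<gamma> S * x * \<pi> y) * ?\<chi> (u * x + v * y)))"
    by (rule sum.swap)
  also have "\<dots> = (\<Sum>S\<in>Pow {..<k}. ?W S * (\<Sum>y\<in>UNIV. \<Sum>x\<in>UNIV.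
      ?\<chi> (sum \<gamma> S * x * \<pi> y) * ?\<chi> (u * x + v * y)))"
    by (simp only: sum_distrib_left)
  also have "\<dots> = (\<Sum>S\<in>Pow {..<k}. 2 ^ m * (?W S * ?\<chi> (\<Sum>i\<in>S. v * \<delta> i)))"
    by (intro sum.cong refl inner)
  also have "\<dots> = 2 ^ m * (\<Prod>i<k. \<omega> i powi trace_int m (v * \<delta> i))"
    by (simp only: prod_trace_powers[OF card] sum_distrib_left)
  \<comment> \<open>Each \<open>\<omega> i\<close> is a power of \<open>\<zeta>\<close>, hence of
    modulus 1.\<close>
  finally show ?thesis
    by (simp add: norm_mult norm_power norm_power_int prod_norm[symmetric] \<omega>_def norm\<zeta>)
qed

section \<open>Powers in the field and in the subfield\<close>

lemma unit_mult_eq_iff: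
  fixes b c :: "'a::field"
  assumes "b * c = 1"
  shows "c * y = w \<longleftrightarrow> y = w * b"
proof
  assume "c * y = w"
  then have "w * b = (b * c) * y" by (simp only: ac_simps)
  then show "y = w * b" by (simp add: assms)
next
  assume "y = w * b"
  then have "c * y = (b * c) * w" by (simp only: ac_simps)
  then show "c * y = w" by (simp add: assms)
qed

lemma field_pow_mult: "field_pow (x * y) n = field_pow x n * field_pow y n"
  by (simp add: field_pow_def power_int_mult_distrib)

lemma field_pow_minus: "x \<noteq> 0 \<Longrightarrow> field_pow x (- n) * field_pow x n = 1"
  by (simp add: field_pow_def power_int_minus)

text \<open>Used in both orders, this makes the power maps for \<open>d\<close> and \<open>e\<close>
  mutually inverse on the whole field, including 0, all of whose powers are 0.\<close>

lemma field_pow_inverse_exponents: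
  fixes x :: "'a::finite_field"
  assumes "CARD('a) = 2 ^ m" and "[d * e = 1] (mod (2 ^ m - 1))"
  shows "field_pow (field_pow x d) e = x"
proof -
  have "field_pow (field_pow x d) e = field_pow x (d * e)"
    by (simp add: field_pow_def power_int_mult)
  also have "\<dots> = field_pow x 1"
    by (rule field_pow_cong) (simp add: assms)
  finally show ?thesis by (simp add: field_pow_def split: if_splits)
qed

text \<open>Multiplication by \<open>b\<close> permutes the nonzero elements of \<open>K\<close>;
  compare their products.\<close>

lemma subfield_power_card_minus_1:
  fixes K :: "'a::finite_field set"
  assumes K: "is_subfield K" and b: "b \<in> K" "b \<noteq> 0"
  shows "b ^ (card K - 1) = 1"
proof -
  let ?U = "K - {0}"
  have "(\<Prod>x\<in>?U. x) = (\<Prod>x\<in>?U. b * x)"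
    by (rule prod.reindex_bij_witness[of _ "\<lambda>x. b * x" "\<lambda>x. inverse b * x"])
      (use K b in \<open>auto simp: is_subfield_def\<close>)
  also have "\<dots> = b ^ card ?U * (\<Prod>x\<in>?U. x)" by (simp add: prod.distrib)
  finally have "b ^ card ?U * (\<Prod>x\<in>?U. x) = 1 * (\<Prod>x\<in>?U. x)" by simp
  moreover have "(\<Prod>x\<in>?U. x) \<noteq> 0" by simp
  ultimately have "b ^ card ?U = 1" by (simp only: mult_cancel_right) simp
  moreover have "card ?U = card K - 1" using K by (simp add: is_subfield_def)
  ultimately show ?thesis by simp
qed

text \<open>Modulo \<open>2 ^ m - 1\<close>, \<open>- e\<close> is \<open>2 + (2 ^ j - 1)\<close>,
  and \<open>2 ^ j - 1\<close> is a multiple of \<open>2 ^ k - 1\<close>, an exponent that sends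
  every nonzero element of \<open>K\<close> to 1.\<close>

lemma subfield_field_pow_square:
  fixes K :: "'a::finite_field set" and b :: 'a
  assumes card: "CARD('a) = 2 ^ m"
    and gcd: "gcd (2 ^ m - 1) (2 ^ j - 1) = (2 ^ k - 1 :: int)"
    and e: "e = 2 ^ m - 2 ^ j - 2"
    and K: "is_subfield K" "card K = 2 ^ k" and b: "b \<in> K"
  shows "field_pow b (- e) = b ^ 2"
proof (cases "b = 0")
  case False
  have "(2 ^ k - 1 :: int) dvd 2 ^ j - 1" using gcd by (metis gcd_dvd2)
  then obtain t where t: "(2 ^ j - 1 :: int) = (2 ^ k - 1) * t" ..
  have "b powi (int (2 ^ k - 1)) = 1"
    using subfield_power_card_minus_1[OF K(1) b False] by (simp only: power_int_of_nat K(2))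
  then have one: "b powi (2 ^ k - 1) = 1" by (simp add: of_nat_diff)
  have "field_pow b (- e) = field_pow b (2 + (2 ^ k - 1) * t)"
    by (rule field_pow_cong, rule cong_sym) (simp add: card e t[symmetric] cong_iff_dvd_diff)
  also have "\<dots> = b ^ 2"
    using False by (simp add: field_pow_def power_int_add power_int_mult one)
  finally show ?thesis .
qed (simp add: field_pow_def)

section \<open>Subset sums of a basis over the prime field\<close>

lemma sum_subset_eq_indicator:
  fixes \<alpha> :: "nat \<Rightarrow> 'a::semiring_1"
  assumes "S \<subseteq> {..<k}"
  shows "sum \<alpha> S = (\<Sum>i<k. of_bool (i \<in> S) * \<alpha> i)"
proof -
  have "(\<Sum>i<k. of_bool (i \<in> S) * \<alpha> i) = (\<Sum>i\<in>S. of_bool (i \<in> S) * \<alpha> i)"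
    using assms by (intro sum.mono_neutral_right) auto
  then show ?thesis by simp
qed

lemma is_F2_basis_sum_mem:
  assumes "is_F2_basis k \<alpha> K" and "S \<subseteq> {..<k}"
  shows "sum \<alpha> S \<in> K"
proof -
  have "sum \<alpha> S \<in> {\<Sum>i<k. c i * \<alpha> i | c. \<forall>i<k. c i \<in> {0, 1}}"
    unfolding sum_subset_eq_indicator[OF assms(2)] mem_Collect_eq
    by (rule exI[of _ "\<lambda>i. of_bool (i \<in> S)"]) simp
  then show ?thesis using assms(1) unfolding is_F2_basis_def by blast
qed

lemma is_F2_basis_sum_nonzero:
  fixes \<alpha> :: "nat \<Rightarrow> 'a::finite_field"
  assumes "is_F2_basis k \<alpha> K" and "S \<subseteq> {..<k}" and "S \<noteq> {}"
  shows "sum \<alpha> S \<noteq> 0"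
proof
  assume "sum \<alpha> S = 0"
  then have zero: "(\<Sum>i<k. of_bool (i \<in> S) * \<alpha> i) = 0"
    by (simp only: sum_subset_eq_indicator[OF assms(2)])
  have indep: "(\<forall>i<k. c i \<in> {0, 1}) \<and> (\<Sum>i<k. c i * \<alpha> i) = 0 \<longrightarrow> (\<forall>i<k. c i = 0)" for c
    using assms(1) unfolding is_F2_basis_def by blast
  have "\<forall>i<k. of_bool (i \<in> S) = (0::'a)"
    by (rule indep[THEN mp, OF conjI[OF _ zero]]) simp
  then have "i \<notin> S" if "i < k" for i using that by simp
  then show False using assms(2,3) by blast
qed

section \<open>Solving the two power equations and deducing bentness\<close>

theorem theorem7:
  fixes m j k :: nat and e d :: int
    and K :: "'a::finite_field set" and \<alpha> :: "nat \<Rightarrow> 'a"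
  assumes "m \<ge> 1"
    and "CARD('a) = 2 ^ m"
    and "gcd (2 ^ m - 1) (2 ^ j + 1) = (1::int)"
    and "gcd (2 ^ m - 1) (2 ^ j - 1) = (2 ^ k - 1 :: int)"
    and "e = 2 ^ m - 2 ^ j - 2"
    and "[d * e = 1] (mod (2 ^ m - 1))"
    and "is_subfield K" and "card K = 2 ^ k"
    and "is_F2_basis k \<alpha> K"
  shows "Z_bent m k (\<lambda>x y. (\<Sum>i<k. trace_int m (\<alpha> i * x * field_pow y d) * 2 ^ i) mod 2 ^ k) \<and>
    Z_bent m k (\<lambda>x y. (\<Sum>i<k. trace_int m (field_pow (\<alpha> i) (- e) * field_pow x e * y) * 2 ^ i) mod 2 ^ k)"
proof -
  note card = \<open>CARD('a) = 2 ^ m\<close> and basis = \<open>is_F2_basis k \<alpha> K\<close>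
  have square: "field_pow b (- e) = b ^ 2" if "b \<in> K" for b
    using subfield_field_pow_square[OF card assms(4,5,7,8) that] .
  have de: "field_pow (field_pow y d) e = y" for y :: 'a
    by (rule field_pow_inverse_exponents[OF card assms(6)])
  have ed: "field_pow (field_pow y e) d = y" for y :: 'a
    by (rule field_pow_inverse_exponents[OF card]) (use assms(6) in \<open>simp add: mult.commute\<close>)
  have sum_sq: "(\<Sum>i\<in>S. \<alpha> i ^ 2) = sum \<alpha> S ^ 2" for S
    by (rule freshmans_dream_sum[symmetric])
      (simp_all only: CHAR_eq_2_if_CARD[OF card] two_is_prime_nat)
  have pow_\<alpha>: "field_pow (\<alpha> i) (- e) = \<alpha> i ^ 2" if "i < k" for i
    using is_F2_basis_sum_mem[OF basis, of "{i}"] that square by simp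
  have bK: "sum \<alpha> S \<in> K" and b0: "sum \<alpha> S \<noteq> 0" if "S \<subseteq> {..<k}" "S \<noteq> {}" for S
    using is_F2_basis_sum_mem[OF basis] is_F2_basis_sum_nonzero[OF basis] that by blast+
  \<comment> \<open>The \<open>e\<close>-th power map is injective, and \<open>?b ^ 2\<close>
    inverts \<open>field_pow ?b e\<close> because \<open>?b\<close> lies in \<open>K\<close>.
    Additivity of squaring then splits the solution over \<open>S\<close>.\<close>
  have sol1: "sum \<alpha> S * field_pow y d = u \<longleftrightarrow> y = (\<Sum>i\<in>S. field_pow u e * \<alpha> i ^ 2)"
    if S: "S \<subseteq> {..<k}" "S \<noteq> {}" for S y u
  proof -
    let ?b = "sum \<alpha> S"
    have inv: "?b ^ 2 * field_pow ?b e = 1"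
      using field_pow_minus[OF b0[OF S], of e] by (simp add: square[OF bK[OF S]])
    have "?b * field_pow y d = u \<longleftrightarrow> field_pow (?b * field_pow y d) e = field_pow u e"
      by (metis ed)
    also have "\<dots> \<longleftrightarrow> field_pow ?b e * y = field_pow u e" by (simp add: field_pow_mult de)
    also have "\<dots> \<longleftrightarrow> y = field_pow u e * ?b ^ 2"
      by (rule unit_mult_eq_iff[OF inv])
    finally show ?thesis by (simp add: sum_sq flip: sum_distrib_left)
  qed
  \<comment> \<open>Dually, apply the \<open>d\<close>-th power map: it turns
    \<open>?b ^ 2 * field_pow ?b e = 1\<close> into \<open>inv'\<close>, so \<open>?b\<close>
    inverts the \<open>d\<close>-th power of \<open>?b ^ 2\<close>.\<close>
  have sol2: "(\<Sum>i\<in>S. \<alpha> i ^ 2) * field_pow x e = v \<longleftrightarrow> x = (\<Sum>i\<in>S. field_pow v d * \<alpha> i)"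
    if S: "S \<subseteq> {..<k}" "S \<noteq> {}" for S x v
  proof -
    let ?b = "sum \<alpha> S"
    have inv: "?b ^ 2 * field_pow ?b e = 1"
      using field_pow_minus[OF b0[OF S], of e] by (simp add: square[OF bK[OF S]])
    have "field_pow (?b ^ 2) d * ?b = field_pow (?b ^ 2 * field_pow ?b e) d"
      by (simp add: field_pow_mult ed)
    then have inv': "field_pow (?b ^ 2) d * ?b = 1"
      by (simp add: inv) (simp add: field_pow_def)
    have "?b ^ 2 * field_pow x e = v \<longleftrightarrow> field_pow (?b ^ 2 * field_pow x e) d = field_pow v d"
      by (metis de)
    also have "\<dots> \<longleftrightarrow> field_pow (?b ^ 2) d * x = field_pow v d" by (simp add: field_pow_mult ed)
    also have "\<dots> \<longleftrightarrow> x = field_pow v d * ?b"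
      by (rule unit_mult_eq_iff) (use inv' in \<open>simp only: mult.commute\<close>)
    finally show ?thesis by (simp add: sum_sq flip: sum_distrib_left)
  qed
  have "Z_bent m k (\<lambda>x y. (\<Sum>i<k. trace_int m (\<alpha> i * x * field_pow y d) * 2 ^ i) mod 2 ^ k)"
    unfolding Z_bent_def
  proof (intro conjI allI impI ballI)
    fix \<zeta> a and u v :: 'a
    assume *: "primitive_root_of_unity (2 ^ k) \<zeta>" "a \<in> {0..<2 ^ k} - {0::int}"
    show "cmod (\<Sum>x\<in>UNIV. \<Sum>y\<in>UNIV.
        \<zeta> powi (a * ((\<Sum>i<k. trace_int m (\<alpha> i * x * field_pow y d) * 2 ^ i) mod 2 ^ k)) *
        (- 1) powi trace_int m (u * x + v * y)) = 2 ^ m"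
      \<comment> \<open>The swap moves \<open>y\<close>, which carries the power map,
        outermost.\<close>
      by (subst sum.swap) (rule cmod_trace_sum_transform[OF card assms(1) *], rule sol1)
  qed simp
  moreover have "Z_bent m k (\<lambda>x y.
      (\<Sum>i<k. trace_int m (field_pow (\<alpha> i) (- e) * field_pow x e * y) * 2 ^ i) mod 2 ^ k)"
    unfolding Z_bent_def
  proof (intro conjI allI impI ballI)
    fix \<zeta> a and u v :: 'a
    assume *: "primitive_root_of_unity (2 ^ k) \<zeta>" "a \<in> {0..<2 ^ k} - {0::int}"
    have "trace_int m (field_pow (\<alpha> i) (- e) * field_pow x e * y) =
        trace_int m (\<alpha> i ^ 2 * y * field_pow x e)" if "i < k" for i x y
      by (simp add: pow_\<alpha>[OF that] mult_ac)
    then have eq: "(\<Sum>i<k. trace_int m (field_pow (\<alpha> i) (- e) * field_pow x e * y) * 2 ^ i) =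
        (\<Sum>i<k. trace_int m (\<alpha> i ^ 2 * y * field_pow x e) * 2 ^ i)" for x y
      by (intro sum.cong) simp_all
    show "cmod (\<Sum>x\<in>UNIV. \<Sum>y\<in>UNIV.
        \<zeta> powi (a * ((\<Sum>i<k. trace_int m (field_pow (\<alpha> i) (- e) * field_pow x e * y) * 2 ^ i) mod 2 ^ k)) *
        (- 1) powi trace_int m (u * x + v * y)) = 2 ^ m"
      \<comment> \<open>Here \<open>x\<close> carries the power map and is already outermost;
        exchanging the linear terms makes \<open>v\<close> the coefficient of the inner
        variable.\<close>
      unfolding eq add.commute[of "u * _"]
      by (rule cmod_trace_sum_transform[OF card assms(1) *]) (rule sol2)
  qed simp
  ultimately show ?thesis ..
qed

end
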